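(* Let $n\ge 1$ and $J\ge n+1$ be integers, let $h>0$, and let $\xi_1<\xi_2<\dots<\xi_{J+n+1}$ be a uniform knot sequence with grid size $h$ (i.e. $\xi_{k+1}-\xi_k=h$). Let $\overline{\xi}_j=\xi_j+h/2$ denote the midpoint of the $j$-th knot interval, let $b_1,\dots,b_J$ be the degree $n$ B-splines on this knot sequence, and let $D^n_\xi$ be their parameter interval. Let $f:\mathbb{R}\to\mathbb{R}$ be a positive function and let $$Qf(x)=\sum_{j=1}^J (Q_jf)\,b_j(x),\qquad Q_jf=\sum_{v=0}^n w_v f(\overline\xi_{j+v}),$$ be its degree $n$ B-spline quasi-interpolant, with $w_0,\dots,w_n$ the midpoint weights. Let $W^+=\{v: w_v>0\}$. Let $M>0$ and $$K_M=\{g:\mathbb{R}\to\mathbb{R}: g(\overline\xi_i)\le g(\overline\xi_j)\exp(M|\overline\xi_i-\overline\xi_j|)\text{ for all } i,j\}.$$ Define $$E(h,n)=\begin{cases}\exp(Mhn)\left(1-\left(\sum_{v\in W^+}w_v\right)^{-1}\right)&\text{if } n \text{ is even},\\ \exp(Mh(n+1))\left(1-\left(\sum_{v\in W^+}w_v\right)^{-1}\right)&\text{if } n\text{ is odd}.\end{cases}$$ If $f\in K_M$ and $E(h,n)<1$, then $Qf(x)>0$ for every $x\in D^n_\xi$.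
   Context: B-splines: for a knot sequence $\xi=\{\xi_k\}$ without repeated knots, $b^0_k(x)=1$ if $\xi_k\le x<\xi_{k+1}$ and $0$ otherwise, and for $n\ge1$ $$b^n_k=\gamma^n_k\, b^{n-1}_k+(1-\gamma^n_{k+1})\,b^{n-1}_{k+1},\qquad \gamma^n_k(x)=\frac{x-\xi_k}{\xi_{k+n}-\xi_k}.$$ Here $b_k=b_k^n$, which has support $[\xi_k,\xi_{k+n+1}]$. The parameter interval $D^n_\xi$ is the maximal interval on which the $b^n_k$ form a partition of unity; for the knots $\xi_1<\dots<\xi_{J+n+1}$ it is $[\xi_{n+1},\xi_{J+1}]$. Midpoint weights: $w_0,\dots,w_n$ are the real numbers satisfying the linear system $$\sum_{v=0}^n w_v (v-j)^n=\prod_{i=1}^n\left(i-j-\tfrac12\right),\qquad j=0,1,\dots,n.$$ They satisfy $\sum_{v=0}^n w_v=1$ and $w_v=w_{n-v}$. In the definition of $K_M$ the indices $i,j$ range over all knot intervals, i.e. $1\le i,j\le J+n$. *)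

theory Defs
  imports "HOL-Analysis.Analysis"
begin

(* Knots are a function on nat of which only the indices 1, ..., J + n + 1 matter:
   b^n_k depends on the knots k, ..., k + n + 1 only. *)

definition bspline_gamma :: "(nat \<Rightarrow> real) \<Rightarrow> nat \<Rightarrow> nat \<Rightarrow> real \<Rightarrow> real" where
  "bspline_gamma \<xi> n k x = (x - \<xi> k) / (\<xi> (k + n) - \<xi> k)"

fun bspline :: "(nat \<Rightarrow> real) \<Rightarrow> nat \<Rightarrow> nat \<Rightarrow> real \<Rightarrow> real" where
  "bspline \<xi> 0 k x = (if \<xi> k \<le> x \<and> x < \<xi> (Suc k) then 1 else 0)"
| "bspline \<xi> (Suc n) k x =
     bspline_gamma \<xi> (Suc n) k x * bspline \<xi> n k x
     + (1 - bspline_gamma \<xi> (Suc n) (Suc k) x) * bspline \<xi> n (Suc k) x"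

definition partition_of_unity_on ::
    "(nat \<Rightarrow> real) \<Rightarrow> nat \<Rightarrow> nat \<Rightarrow> real set \<Rightarrow> bool" where
  "partition_of_unity_on \<xi> n J D \<longleftrightarrow>
     (\<forall>x\<in>D. (\<forall>k\<in>{1..J}. 0 \<le> bspline \<xi> n k x) \<and> (\<Sum>k=1..J. bspline \<xi> n k x) = 1)"

(* Existence and uniqueness of the maximal interval, and its explicit form,
   are shown in parameter_interval_eq below. *)
definition parameter_interval :: "(nat \<Rightarrow> real) \<Rightarrow> nat \<Rightarrow> nat \<Rightarrow> real set" where
  "parameter_interval \<xi> n J =
     (THE D. is_interval D \<and> partition_of_unity_on \<xi> n J D \<and>
        (\<forall>D'. is_interval D' \<and> partition_of_unity_on \<xi> n J D' \<and> D \<subseteq> D' \<longrightarrow> D' = D))"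

definition midpoint_weights :: "nat \<Rightarrow> (nat \<Rightarrow> real) \<Rightarrow> bool" where
  "midpoint_weights n w \<longleftrightarrow>
     (\<forall>j\<in>{0..n}. (\<Sum>v=0..n. w v * (real v - real j) ^ n)
                 = (\<Prod>i=1..n. real i - real j - 1 / 2))"

definition knot_midpoint :: "(nat \<Rightarrow> real) \<Rightarrow> real \<Rightarrow> nat \<Rightarrow> real" where
  "knot_midpoint \<xi> h j = \<xi> j + h / 2"

definition qi_coeff ::
    "(nat \<Rightarrow> real) \<Rightarrow> (nat \<Rightarrow> real) \<Rightarrow> real \<Rightarrow> nat \<Rightarrow> (real \<Rightarrow> real) \<Rightarrow> nat \<Rightarrow> real" where
  "qi_coeff w \<xi> h n f j = (\<Sum>v=0..n. w v * f (knot_midpoint \<xi> h (j + v)))"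

definition quasi_interpolant ::
    "(nat \<Rightarrow> real) \<Rightarrow> (nat \<Rightarrow> real) \<Rightarrow> real \<Rightarrow> nat \<Rightarrow> nat \<Rightarrow> (real \<Rightarrow> real) \<Rightarrow> real \<Rightarrow> real" where
  "quasi_interpolant w \<xi> h n J f x = (\<Sum>j=1..J. qi_coeff w \<xi> h n f j * bspline \<xi> n j x)"

definition K_class ::
    "(nat \<Rightarrow> real) \<Rightarrow> real \<Rightarrow> nat \<Rightarrow> nat \<Rightarrow> real \<Rightarrow> (real \<Rightarrow> real) set" where
  "K_class \<xi> h n J M =
     {g. \<forall>i\<in>{1..J + n}. \<forall>j\<in>{1..J + n}.
        g (knot_midpoint \<xi> h i)
          \<le> g (knot_midpoint \<xi> h j) * exp (M * \<bar>knot_midpoint \<xi> h i - knot_midpoint \<xi> h j\<bar>)}"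

definition W_plus :: "nat \<Rightarrow> (nat \<Rightarrow> real) \<Rightarrow> nat set" where
  "W_plus n w = {v \<in> {0..n}. w v > 0}"

definition E_bound :: "(nat \<Rightarrow> real) \<Rightarrow> real \<Rightarrow> real \<Rightarrow> nat \<Rightarrow> real" where
  "E_bound w M h n =
     (if even n then exp (M * h * real n) * (1 - inverse (\<Sum>v\<in>W_plus n w. w v))
      else exp (M * h * (real n + 1)) * (1 - inverse (\<Sum>v\<in>W_plus n w. w v)))"

lemma bspline_eq_0_left:
  assumes "strict_mono_on {a..b} \<xi>" "a \<le> k" "k + n + 1 \<le> b" "x < \<xi> k"
  shows "bspline \<xi> n k x = 0"
  using assms(2-)
proof (induction n arbitrary: k)
  case 0
  then show ?case by simp
next
  case (Suc n)
  have "\<xi> k < \<xi> (Suc k)"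
    using assms(1) Suc.prems by (intro strict_mono_onD[OF assms(1)]) auto
  then show ?case using Suc.IH[of k] Suc.IH[of "Suc k"] Suc.prems by simp
qed

lemma bspline_eq_0_right:
  assumes "strict_mono_on {a..b} \<xi>" "a \<le> k" "k + n + 1 \<le> b" "\<xi> (k + n + 1) \<le> x"
  shows "bspline \<xi> n k x = 0"
  using assms(2-)
proof (induction n arbitrary: k)
  case 0
  then show ?case by simp
next
  case (Suc n)
  have "\<xi> (k + n + 1) < \<xi> (k + Suc n + 1)"
    using Suc.prems by (intro strict_mono_onD[OF assms(1)]) auto
  then show ?case using Suc.IH[of k] Suc.IH[of "Suc k"] Suc.prems by simp
qed

lemma bspline_gamma_bounds:
  assumes "strict_mono_on {a..b} \<xi>" "a \<le> k" "k + Suc n \<le> b"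
  shows "\<xi> k < x \<Longrightarrow> 0 < bspline_gamma \<xi> (Suc n) k x"
    and "x < \<xi> (k + Suc n) \<Longrightarrow> bspline_gamma \<xi> (Suc n) k x < 1"
    and "\<xi> k \<le> x \<Longrightarrow> 0 \<le> bspline_gamma \<xi> (Suc n) k x"
proof -
  have "\<xi> k < \<xi> (k + Suc n)"
    using assms by (intro strict_mono_onD[OF assms(1)]) auto
  then show "\<xi> k < x \<Longrightarrow> 0 < bspline_gamma \<xi> (Suc n) k x"
    and "x < \<xi> (k + Suc n) \<Longrightarrow> bspline_gamma \<xi> (Suc n) k x < 1"
    and "\<xi> k \<le> x \<Longrightarrow> 0 \<le> bspline_gamma \<xi> (Suc n) k x"
    by (auto simp: bspline_gamma_def)
qed

lemma bspline_nonneg: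
  assumes "strict_mono_on {a..b} \<xi>" "a \<le> k" "k + n + 1 \<le> b"
  shows "0 \<le> bspline \<xi> n k x"
  using assms(2-)
proof (induction n arbitrary: k)
  case 0
  then show ?case by simp
next
  case (Suc n)
  have "0 \<le> bspline_gamma \<xi> (Suc n) k x * bspline \<xi> n k x"
  proof (cases "x < \<xi> k")
    case True
    then show ?thesis using bspline_eq_0_left[OF assms(1), of k n x] Suc.prems by simp
  next
    case False
    then show ?thesis
      using bspline_gamma_bounds(3)[OF assms(1), of k n x] Suc.IH[of k] Suc.prems by simp
  qed
  moreover have "0 \<le> (1 - bspline_gamma \<xi> (Suc n) (Suc k) x) * bspline \<xi> n (Suc k) x"
  proof (cases "x < \<xi> (Suc k + Suc n)")
    case True
    then show ?thesis
      using bspline_gamma_bounds(2)[OF assms(1), of "Suc k" n x] Suc.IH[of "Suc k"] Suc.prems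
      by simp
  next
    case False
    then show ?thesis
      using bspline_eq_0_right[OF assms(1), of "Suc k" n x] Suc.prems by simp
  qed
  ultimately show ?case by simp
qed

lemma bspline_pos:
  assumes "strict_mono_on {a..b} \<xi>" "a \<le> k" "k + n + 1 \<le> b"
    and "\<xi> k < x" "x < \<xi> (k + n + 1)"
  shows "0 < bspline \<xi> n k x"
  using assms(2-)
proof (induction n arbitrary: k)
  case 0
  then show ?case by simp
next
  case (Suc n)
  have g1: "0 < bspline_gamma \<xi> (Suc n) k x"
    using bspline_gamma_bounds(1)[OF assms(1), of k n x] Suc.prems by simp
  have g2: "0 < 1 - bspline_gamma \<xi> (Suc n) (Suc k) x"
    using bspline_gamma_bounds(2)[OF assms(1), of "Suc k" n x] Suc.prems by simp
  have n1: "0 \<le> bspline \<xi> n k x" and n2: "0 \<le> bspline \<xi> n (Suc k) x"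
    using bspline_nonneg[OF assms(1), of k n x] bspline_nonneg[OF assms(1), of "Suc k" n x]
      Suc.prems by auto
  show ?case
  proof (cases "x < \<xi> (k + n + 1)")
    case True
    have "0 < bspline \<xi> n k x" using Suc.IH[of k] Suc.prems True by simp
    then show ?thesis using g1 g2 n2
      by (simp add: add_pos_nonneg)
  next
    case False
    show ?thesis
    proof (cases "n = 0")
      case True
      then show ?thesis using g1 g2 False Suc.prems by simp
    next
      case n: False
      have "\<xi> (Suc k) < \<xi> (k + n + 1)"
        using n Suc.prems by (intro strict_mono_onD[OF assms(1)]) auto
      then have "0 < bspline \<xi> n (Suc k) x"
        using Suc.IH[of "Suc k"] Suc.prems False by simp
      then show ?thesis using g1 g2 n1
        by (simp add: add_nonneg_pos)
    qed
  qed
qed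

lemma bspline_at_left_knot:
  assumes "strict_mono_on {a..b} \<xi>" "a \<le> k" "k + Suc n + 1 \<le> b"
  shows "bspline \<xi> (Suc n) k (\<xi> k) = 0"
proof -
  have "\<xi> k < \<xi> (Suc k)"
    using assms by (intro strict_mono_onD[OF assms(1)]) auto
  then show ?thesis
    using bspline_eq_0_left[OF assms(1), of "Suc k" n "\<xi> k"] assms
    by (simp add: bspline_gamma_def)
qed

lemma sum_bspline_Suc:
  assumes "a \<le> c"
  shows "(\<Sum>k=a..c. bspline \<xi> (Suc n) k x) =
    bspline_gamma \<xi> (Suc n) a x * bspline \<xi> n a x + (\<Sum>k=Suc a..c. bspline \<xi> n k x)
    + (1 - bspline_gamma \<xi> (Suc n) (Suc c) x) * bspline \<xi> n (Suc c) x"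
  using assms
proof (induction c rule: dec_induct)
  case base
  then show ?case by simp
next
  case (step m)
  then show ?case by (simp add: algebra_simps)
qed

lemma sum_bspline_le_1:
  assumes "strict_mono_on {a..b} \<xi>" "a \<le> c" "c + n + 1 \<le> b"
  shows "(\<Sum>k=a..c. bspline \<xi> n k x) \<le> 1"
    and "0 < n \<Longrightarrow> \<not> (\<xi> (a + n) \<le> x \<and> x \<le> \<xi> (c + 1)) \<Longrightarrow> (\<Sum>k=a..c. bspline \<xi> n k x) < 1"
proof -
  have mono: "\<xi> i < \<xi> j" if "a \<le> i" "i < j" "j \<le> b" for i j
    using that by (intro strict_mono_onD[OF assms(1)]) auto
  have step: "bspline_gamma \<xi> (Suc m) a x * bspline \<xi> m a x \<le> bspline \<xi> m a x"
    and step': "(1 - bspline_gamma \<xi> (Suc m) (Suc d) x) * bspline \<xi> m (Suc d) x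
        \<le> bspline \<xi> m (Suc d) x"
    and split: "(\<Sum>k=a..Suc d. bspline \<xi> m k x)
        = bspline \<xi> m a x + (\<Sum>k=Suc a..d. bspline \<xi> m k x) + bspline \<xi> m (Suc d) x"
    if "a \<le> d" "d + Suc m + 1 \<le> b" for d m
  proof -
    show "bspline_gamma \<xi> (Suc m) a x * bspline \<xi> m a x \<le> bspline \<xi> m a x"
    proof (cases "x < \<xi> (a + Suc m)")
      case True
      then show ?thesis
        using bspline_gamma_bounds(2)[OF assms(1), of a m x] bspline_nonneg[OF assms(1), of a m x]
          that mult_right_mono[of "bspline_gamma \<xi> (Suc m) a x" 1 "bspline \<xi> m a x"] by simp
    next
      case False
      then show ?thesis using bspline_eq_0_right[OF assms(1), of a m x] that by simp
    qed
    show "(1 - bspline_gamma \<xi> (Suc m) (Suc d) x) * bspline \<xi> m (Suc d) x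
        \<le> bspline \<xi> m (Suc d) x"
    proof (cases "x < \<xi> (Suc d)")
      case True
      then show ?thesis using bspline_eq_0_left[OF assms(1), of "Suc d" m x] that by simp
    next
      case False
      then show ?thesis
        using bspline_gamma_bounds(3)[OF assms(1), of "Suc d" m x]
          bspline_nonneg[OF assms(1), of "Suc d" m x] that
        by (simp add: left_diff_distrib)
    qed
    show "(\<Sum>k=a..Suc d. bspline \<xi> m k x)
        = bspline \<xi> m a x + (\<Sum>k=Suc a..d. bspline \<xi> m k x) + bspline \<xi> m (Suc d) x"
      using that by (simp add: sum.atLeast_Suc_atMost)
  qed
  have zero: "(\<Sum>k=a..d. bspline \<xi> 0 k x) = (if \<xi> a \<le> x \<and> x < \<xi> (Suc d) then 1 else 0)"
    if "a \<le> d" "Suc d \<le> b" for d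
    using that
  proof (induction d rule: dec_induct)
    case base
    then show ?case by simp
  next
    case (step d)
    then show ?case using mono[of a "Suc d"] mono[of "Suc d" "Suc (Suc d)"] by simp
  qed
  have le: "(\<Sum>k=a..d. bspline \<xi> m k x) \<le> 1" if "a \<le> d" "d + m + 1 \<le> b" for d m
    using that
  proof (induction m arbitrary: d)
    case 0
    then show ?case using zero[of d] by simp
  next
    case (Suc m)
    have "(\<Sum>k=a..d. bspline \<xi> (Suc m) k x) \<le> (\<Sum>k=a..Suc d. bspline \<xi> m k x)"
      unfolding sum_bspline_Suc[OF Suc.prems(1)] split[OF Suc.prems]
      using step[OF Suc.prems] step'[OF Suc.prems] by linarith
    also have "\<dots> \<le> 1" using Suc.IH[of "Suc d"] Suc.prems by simp
    finally show ?case .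
  qed
  then show "(\<Sum>k=a..c. bspline \<xi> n k x) \<le> 1" using assms by blast
  assume "0 < n" and out: "\<not> (\<xi> (a + n) \<le> x \<and> x \<le> \<xi> (c + 1))"
  then obtain m where n: "n = Suc m" by (cases n) auto
  have pre: "a \<le> c" "c + Suc m + 1 \<le> b" using assms n by auto
  have le1: "(\<Sum>k=a..Suc c. bspline \<xi> m k x) \<le> 1" using le[of "Suc c" m] pre by simp
  consider "x \<le> \<xi> a" | "\<xi> a < x" "x < \<xi> (a + n)"
    | "\<xi> (c + 1) < x" "x < \<xi> (c + n + 1)" | "\<xi> (c + n + 1) \<le> x"
    using out by linarith
  then show "(\<Sum>k=a..c. bspline \<xi> n k x) < 1"
  proof cases
    case 1
    have "bspline \<xi> n k x = 0" if "k \<in> {a..c}" for k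
    proof (cases "x < \<xi> k")
      case True
      then show ?thesis using bspline_eq_0_left[OF assms(1), of k n x] that assms by simp
    next
      case False
      then have "x = \<xi> k" using 1 mono[of a k] that assms
        by (cases "k = a") auto
      then show ?thesis using bspline_at_left_knot[OF assms(1), of k m] that assms n by simp
    qed
    then show ?thesis by simp
  next
    case 2
    have "0 < bspline \<xi> m a x" using bspline_pos[OF assms(1), of a m x] 2 n pre by simp
    moreover have "bspline_gamma \<xi> (Suc m) a x < 1"
      using bspline_gamma_bounds(2)[OF assms(1), of a m x] 2 n pre by simp
    ultimately have "bspline_gamma \<xi> (Suc m) a x * bspline \<xi> m a x < bspline \<xi> m a x"
      by simp
    then show ?thesis
      using step'[OF pre] le1 unfolding n sum_bspline_Suc[OF pre(1)] split[OF pre] by linarith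
  next
    case 3
    have "0 < bspline \<xi> m (Suc c) x" using bspline_pos[OF assms(1), of "Suc c" m x] 3 n pre by simp
    moreover have "0 < bspline_gamma \<xi> (Suc m) (Suc c) x"
      using bspline_gamma_bounds(1)[OF assms(1), of "Suc c" m x] 3 n pre by simp
    ultimately have "(1 - bspline_gamma \<xi> (Suc m) (Suc c) x) * bspline \<xi> m (Suc c) x
        < bspline \<xi> m (Suc c) x"
      by simp
    then show ?thesis
      using step[OF pre] le1 unfolding n sum_bspline_Suc[OF pre(1)] split[OF pre] by linarith
  next
    case 4
    have "bspline \<xi> n k x = 0" if "k \<in> {a..c}" for k
    proof -
      have "\<xi> (k + n + 1) \<le> \<xi> (c + n + 1)"
        using mono[of "k + n + 1" "c + n + 1"] that assms by (cases "k = c") auto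
      then show ?thesis using 4 bspline_eq_0_right[OF assms(1), of k n x] that assms by simp
    qed
    then show ?thesis by simp
  qed
qed

lemma sum_bspline_eq_1:
  assumes "strict_mono_on {a..b} \<xi>" "a \<le> c" "c + n + 1 \<le> b" "0 < n"
    and "\<xi> (a + n) \<le> x" "x \<le> \<xi> (c + 1)"
  shows "(\<Sum>k=a..c. bspline \<xi> n k x) = 1"
proof -
  have mono: "\<xi> i < \<xi> j" if "a \<le> i" "i < j" "j \<le> b" for i j
    using that by (intro strict_mono_onD[OF assms(1)]) auto
  have "(\<Sum>k=d..c. bspline \<xi> (Suc m) k x) = 1"
    if "a \<le> d" "d \<le> c" "c + Suc m + 1 \<le> b" "\<xi> (d + Suc m) \<le> x" for d m
    using that
  proof (induction m arbitrary: d)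
    case 0
    have b0: "(\<Sum>k=Suc d..e. bspline \<xi> 0 k x) = (if \<xi> (Suc d) \<le> x \<and> x < \<xi> (Suc e) then 1 else 0)"
      if "d \<le> e" "Suc e \<le> b" for e
      using that
    proof (induction e rule: dec_induct)
      case base
      then show ?case by simp
    next
      case (step e)
      then show ?case using mono[of "Suc d" "Suc e"] mono[of "Suc e" "Suc (Suc e)"] 0
        by (cases "e = d") auto
    qed
    have "\<xi> (Suc c) < \<xi> (Suc (Suc c))" using 0 by (intro mono) auto
    then show ?case
      unfolding sum_bspline_Suc[OF 0(2)]
      using b0[of c] 0 assms(6) by (auto simp: bspline_gamma_def)
  next
    case (Suc m)
    have "d < c"
    proof (rule ccontr)
      assume "\<not> d < c"
      then have "d = c" using Suc.prems by simp
      then have "\<xi> (c + 1) < \<xi> (d + Suc (Suc m))"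
        using Suc.prems by (intro mono) auto
      then show False using Suc.prems assms(6) by simp
    qed
    have l: "bspline \<xi> (Suc m) d x = 0"
      using bspline_eq_0_right[OF assms(1), of d "Suc m" x] Suc.prems by simp
    have r: "bspline \<xi> (Suc m) (Suc c) x = 0"
    proof (cases "x = \<xi> (Suc c)")
      case True
      then show ?thesis using bspline_at_left_knot[OF assms(1), of "Suc c" m] Suc.prems by simp
    next
      case False
      then show ?thesis
        using bspline_eq_0_left[OF assms(1), of "Suc c" "Suc m" x] Suc.prems assms(6) by simp
    qed
    show ?case
      unfolding sum_bspline_Suc[OF Suc.prems(2)] l r
      using Suc.IH[of "Suc d"] Suc.prems \<open>d < c\<close> by simp
  qed
  moreover obtain m where "n = Suc m" using assms(4) by (cases n) auto
  ultimately show ?thesis using assms by auto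
qed

lemma parameter_interval_eq:
  assumes "strict_mono_on {1..J + n + 1} \<xi>" "1 \<le> n" "1 \<le> J"
  shows "parameter_interval \<xi> n J = {\<xi> (n + 1)..\<xi> (J + 1)}"
proof -
  let ?I = "{\<xi> (n + 1)..\<xi> (J + 1)}"
  have iff: "partition_of_unity_on \<xi> n J D \<longleftrightarrow> D \<subseteq> ?I" for D
  proof -
    have "0 \<le> bspline \<xi> n k x" if "k \<in> {1..J}" for k x
      using bspline_nonneg[OF assms(1), of k n x] that by simp
    moreover have "(\<Sum>k=1..J. bspline \<xi> n k x) = 1 \<longleftrightarrow> x \<in> ?I" for x
    proof
      assume *: "(\<Sum>k=1..J. bspline \<xi> n k x) = 1"
      show "x \<in> ?I"
      proof (rule ccontr)
        assume "x \<notin> ?I"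
        then have "(\<Sum>k=1..J. bspline \<xi> n k x) < 1"
          using assms(2,3) by (intro sum_bspline_le_1(2)[OF assms(1)]) (auto simp: add.commute)
        then show False using * by linarith
      qed
    next
      assume "x \<in> ?I"
      then show "(\<Sum>k=1..J. bspline \<xi> n k x) = 1"
        using assms(2,3) by (intro sum_bspline_eq_1[OF assms(1)]) (auto simp: add.commute)
    qed
    ultimately show ?thesis unfolding partition_of_unity_on_def by blast
  qed
  show ?thesis
    unfolding parameter_interval_def iff
    by (rule the_equality) (use is_interval_cc in blast)+
qed

end

theory Submission
  imports Defs
begin

text \<open>
  The interpolant is positive because every one of its coefficients \<open>Q\<^sub>j f\<close> is: on the parameter
  interval the B-splines are nonnegative and sum to 1, so at each point at least one of them is
  positive.

  The coefficient \<open>Q\<^sub>j f\<close> is a combination of \<open>n + 1\<close> consecutive midpoint values of \<open>f\<close> with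
  weights that sum to 1 (\<open>sum_midpoint_weights\<close>), but some weights may be negative.  Let \<open>S\<close> be
  the sum of the positive weights, so that the other ones sum to \<open>1 - S\<close>, and let \<open>m\<close> be the
  smallest of the values.  The midpoints are at most \<open>n h\<close> apart, so the growth condition on \<open>f\<close>
  bounds all values by \<open>c m\<close> with \<open>c = exp (M h n)\<close>, and the combination is at least
  \<open>S m + (1 - S) c m = S m (1 - c (1 - 1 / S))\<close>
  (\<open>weighted_sum_pos\<close>).  The hypothesis on \<open>E(h,n)\<close> says exactly that the last factor is positive
  when \<open>n\<close> is even.  When \<open>n\<close> is odd it says at least as much, since \<open>S \<ge> 1\<close> makes \<open>1 - 1 / S\<close>
  nonnegative.
\<close>

text \<open>
  After multiplication with \<open>(-1) ^ n\<close> the two sides of the system are the values at \<open>j\<close> of the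
  polynomials \<open>\<Sum>v. w v * (x - v) ^ n\<close> and \<open>\<Prod>i. (x - (i - 1/2))\<close>.  Both have degree at most
  \<open>n\<close> and they agree at the \<open>n + 1\<close> points \<open>0, ..., n\<close>, hence their coefficients of \<open>x ^ n\<close>
  agree; these are \<open>\<Sum>v. w v\<close> and \<open>1\<close>.
\<close>

lemma sum_midpoint_weights:
  assumes "midpoint_weights n w"
  shows "(\<Sum>v=0..n. w v) = 1"
proof -
  define p where "p = (\<Sum>v=0..n. smult (w v) ([:- real v, 1:] ^ n))"
  define q where "q = (\<Prod>i=1..n. [:1 / 2 - real i, 1:])"
  have "lead_coeff q = 1"
    by (simp add: q_def lead_coeff_prod)
  moreover have deg_q: "degree q = n"
    unfolding q_def by (subst degree_prod_eq_sum_degree) auto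
  ultimately have coeff_q: "coeff q n = 1"
    by simp
  have coeff_p: "coeff p n = (\<Sum>v=0..n. w v)"
    by (simp add: p_def coeff_sum coeff_linear_power)
  have deg_p: "degree p \<le> n"
    unfolding p_def by (intro degree_sum_le) (auto simp: degree_linear_power)
  have agree: "poly p x = poly q x" if x: "x \<in> real ` {0..n}" for x
  proof -
    obtain j where j: "j \<in> {0..n}" "x = real j"
      using x by blast
    have "poly p x = (\<Sum>v=0..n. (- 1) ^ n * (w v * (real v - real j) ^ n))"
    proof -
      have "(real j - real v) ^ n = (- 1) ^ n * (real v - real j) ^ n" for v
        by (simp flip: power_mult_distrib)
      then show ?thesis
        by (simp add: p_def j poly_sum mult_ac)
    qed
    also have "\<dots> = (- 1) ^ n * (\<Prod>i=1..n. real i - real j - 1 / 2)"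
      using assms j by (simp add: midpoint_weights_def flip: sum_distrib_left)
    also have "\<dots> = (\<Prod>i=1..n. - 1 * (real i - real j - 1 / 2))"
      unfolding prod.distrib by simp
    also have "\<dots> = poly q x"
      unfolding q_def poly_prod j by (intro prod.cong) auto
    finally show ?thesis .
  qed
  have "card (real ` {0..n}) = n + 1"
    by (simp add: card_image)
  then have "p = q"
    using deg_p deg_q by (intro poly_eqI_degree[OF agree]) auto
  then show ?thesis
    using coeff_p coeff_q by simp
qed

lemma sum_le_sum_positive_part:
  fixes w :: "'a \<Rightarrow> real"
  assumes "finite A"
  shows "(\<Sum>v\<in>A. w v) \<le> (\<Sum>v\<in>{v \<in> A. 0 < w v}. w v)"
  unfolding sum.inter_filter[OF assms] by (intro sum_mono) auto

text \<open>
  Bounding the values with positive weight from below by the smallest value \<open>m\<close>, and those with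
  nonpositive weight from above by \<open>c m\<close>, leaves \<open>m\<close> times a factor that the hypothesis on \<open>c\<close>
  makes positive.
\<close>

lemma weighted_sum_pos:
  fixes w g :: "'a \<Rightarrow> real"
  assumes "finite A" and sum_w: "(\<Sum>v\<in>A. w v) = 1"
    and pos: "\<And>v. v \<in> A \<Longrightarrow> 0 < g v"
    and ratio: "\<And>u v. u \<in> A \<Longrightarrow> v \<in> A \<Longrightarrow> g u \<le> g v * c"
    and c: "c * (1 - inverse (\<Sum>v\<in>{v \<in> A. 0 < w v}. w v)) < 1"
  shows "0 < (\<Sum>v\<in>A. w v * g v)"
proof -
  define P where "P = {v \<in> A. 0 < w v}"
  define S where "S = (\<Sum>v\<in>P. w v)"
  have split: "(\<Sum>v\<in>A. F v) = (\<Sum>v\<in>P. F v) + (\<Sum>v\<in>A - P. F v)" for F :: "'a \<Rightarrow> real"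
    using sum.subset_diff[of P A F] \<open>finite A\<close> by (simp add: P_def)
  have rest: "(\<Sum>v\<in>A - P. w v) = 1 - S"
    using split[of w] sum_w by (simp add: S_def)
  have "S \<ge> 1"
    using sum_le_sum_positive_part[OF \<open>finite A\<close>, of w] sum_w by (simp add: S_def P_def)
  have "A \<noteq> {}"
    using sum_w by auto
  then obtain u where u: "u \<in> A" "\<And>v. v \<in> A \<Longrightarrow> g u \<le> g v"
    using \<open>finite A\<close> by (metis arg_min_if_finite(1) arg_min_least)
  have "0 < 1 - c * (1 - inverse S)"
    using c by (simp add: S_def P_def)
  then have "0 < (g u * S) * (1 - c * (1 - inverse S))"
    using pos[OF u(1)] \<open>S \<ge> 1\<close> by (intro mult_pos_pos) auto
  also have "\<dots> = S * g u + (1 - S) * (g u * c)"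
    using \<open>S \<ge> 1\<close> by (simp add: field_simps)
  also have "\<dots> = (\<Sum>v\<in>P. w v * g u) + (\<Sum>v\<in>A - P. w v * (g u * c))"
    by (simp only: sum_distrib_right[symmetric] rest S_def)
  also have "\<dots> \<le> (\<Sum>v\<in>P. w v * g v) + (\<Sum>v\<in>A - P. w v * g v)"
    using u ratio[OF _ u(1)]
    by (intro add_mono sum_mono mult_left_mono mult_left_mono_neg) (auto simp: P_def)
  also have "\<dots> = (\<Sum>v\<in>A. w v * g v)"
    by (rule split[symmetric])
  finally show ?thesis .
qed

lemma uniform_knots_eq:
  assumes "\<forall>k\<in>{1..N}. \<xi> (k + 1) - \<xi> k = (h :: real)" and "1 \<le> k" and "k \<le> N + 1"
  shows "\<xi> k = \<xi> 1 + (real k - 1) * h"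
  using assms(2,3)
proof (induction k rule: dec_induct)
  case base
  then show ?case by simp
next
  case (step m)
  then have "\<xi> (m + 1) - \<xi> m = h"
    by (intro bspec[OF assms(1)]) auto
  then show ?case
    using step by (simp add: algebra_simps)
qed

text \<open>
  The factor \<open>1 - 1 / S\<close> is nonnegative because the positive weights sum to \<open>S \<ge> 1\<close>; therefore the
  exponent \<open>n + 1\<close> used for odd \<open>n\<close> can be lowered to \<open>n\<close>.
\<close>

lemma exp_growth_bound_if_E_bound:
  assumes "midpoint_weights n w" and "0 \<le> M * h" and "E_bound w M h n < 1"
  shows "exp (M * h * real n) * (1 - inverse (\<Sum>v\<in>W_plus n w. w v)) < 1"
proof -
  define S where "S = (\<Sum>v\<in>W_plus n w. w v)"
  have "(\<Sum>v=0..n. w v) \<le> S"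
    unfolding S_def W_plus_def by (intro sum_le_sum_positive_part) simp
  then have "0 \<le> 1 - inverse S"
    using sum_midpoint_weights[OF assms(1)] by (simp add: inverse_le_1_iff)
  moreover have "exp (M * h * real n) \<le> exp (M * h * (real n + 1))"
    using assms(2) by (simp add: algebra_simps)
  ultimately have "exp (M * h * real n) * (1 - inverse S) \<le> exp (M * h * (real n + 1)) * (1 - inverse S)"
    by (rule mult_right_mono[rotated])
  then show ?thesis
    using assms(3) by (auto simp: E_bound_def S_def split: if_splits)
qed

lemma qi_coeff_pos:
  assumes "midpoint_weights n w"
    and uniform: "\<forall>k\<in>{1..J + n}. \<xi> (k + 1) - \<xi> k = h"
    and "0 \<le> h" "0 \<le> M" and "E_bound w M h n < 1"
    and pos: "\<forall>x. 0 < f x" and K: "f \<in> K_class \<xi> h n J M"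
    and j: "j \<in> {1..J}"
  shows "0 < qi_coeff w \<xi> h n f j"
  unfolding qi_coeff_def
proof (rule weighted_sum_pos)
  let ?t = "\<lambda>v. knot_midpoint \<xi> h (j + v)"
  fix u v assume uv: "u \<in> {0..n}" "v \<in> {0..n}"
  have "?t u - ?t v = (real u - real v) * h"
    using uniform_knots_eq[OF uniform, of "j + u"] uniform_knots_eq[OF uniform, of "j + v"] uv j
    by (simp add: knot_midpoint_def algebra_simps)
  then have "\<bar>?t u - ?t v\<bar> = \<bar>real u - real v\<bar> * h"
    using \<open>0 \<le> h\<close> by (simp add: abs_mult)
  also have "\<dots> \<le> real n * h"
    using uv \<open>0 \<le> h\<close> by (intro mult_right_mono) auto
  finally have "M * \<bar>?t u - ?t v\<bar> \<le> M * (real n * h)"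
    using \<open>0 \<le> M\<close> by (rule mult_left_mono)
  then have "M * \<bar>?t u - ?t v\<bar> \<le> M * h * real n"
    by (simp add: mult_ac)
  then have "f (?t v) * exp (M * \<bar>?t u - ?t v\<bar>) \<le> f (?t v) * exp (M * h * real n)"
    using pos by (simp add: less_imp_le)
  moreover have "f (?t u) \<le> f (?t v) * exp (M * \<bar>?t u - ?t v\<bar>)"
    using K uv j unfolding K_class_def by auto
  ultimately show "f (?t u) \<le> f (?t v) * exp (M * h * real n)"
    by linarith
next
  show "exp (M * h * real n) * (1 - inverse (\<Sum>v\<in>{v \<in> {0..n}. 0 < w v}. w v)) < 1"
    using exp_growth_bound_if_E_bound[OF assms(1) _ assms(5)] \<open>0 \<le> h\<close> \<open>0 \<le> M\<close>
    by (simp add: W_plus_def)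
qed (use pos sum_midpoint_weights[OF assms(1)] in auto)

theorem theorem3p1:
  fixes n J :: nat and h M :: real and \<xi> w :: "nat \<Rightarrow> real" and f :: "real \<Rightarrow> real"
  assumes "n \<ge> 1" and "J \<ge> n + 1" and "h > 0"
    and "strict_mono_on {1..J + n + 1} \<xi>"
    and "\<forall>k\<in>{1..J + n}. \<xi> (k + 1) - \<xi> k = h"
    and "midpoint_weights n w"
    and "\<forall>x. f x > 0"
    and "M > 0"
    and "f \<in> K_class \<xi> h n J M"
    and "E_bound w M h n < 1"
  shows "\<forall>x\<in>parameter_interval \<xi> n J. quasi_interpolant w \<xi> h n J f x > 0"
proof
  fix x assume "x \<in> parameter_interval \<xi> n J"
  then have "\<xi> (1 + n) \<le> x" "x \<le> \<xi> (J + 1)"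
    using parameter_interval_eq[OF assms(4,1)] assms(2) by (auto simp: add.commute)
  then have unity: "(\<Sum>j=1..J. bspline \<xi> n j x) = 1"
    using assms(1,2) by (intro sum_bspline_eq_1[OF assms(4)]) auto
  have nonneg: "0 \<le> bspline \<xi> n j x" if "j \<in> {1..J}" for j
    using bspline_nonneg[OF assms(4), of j n x] that by simp
  have coeff: "0 < qi_coeff w \<xi> h n f j" if "j \<in> {1..J}" for j
    using qi_coeff_pos[OF assms(6,5) _ _ assms(10,7,9) that] assms(3,8) by simp
  obtain k where k: "k \<in> {1..J}" "bspline \<xi> n k x \<noteq> 0"
    using unity by (metis sum.neutral zero_neq_one)
  then have "0 < bspline \<xi> n k x"
    using nonneg[of k] by simp
  then show "0 < quasi_interpolant w \<xi> h n J f x"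
    unfolding quasi_interpolant_def
    using k nonneg coeff
    by (intro sum_pos2[of _ k]) (auto simp: less_imp_le)
qed

end
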